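(* Consider the noisy-invariant family model with invariant signal strength $\gamma\in(0,1]$, training families $e_1,\dots,e_m$, weights $\alpha_1,\dots,\alpha_m$ and average training shortcut correlation $\bar\rho_{\mathrm{train}}=\sum_{i=1}^m\alpha_i\rho_{e_i}$. Let $\lambda>0$ and let $\hat w^\lambda=(\hat w_Z^\lambda,\hat w_S^\lambda)\in\mathbb{R}^2$ denote the ridge-logistic minimizer, i.e. the minimizer over $w=(w_Z,w_S)\in\mathbb{R}^2$ of $$J^{\mathrm{noisy}}_\lambda(w_Z,w_S)=\mathbb{E}_{\mathrm{train}}\bigl[\ell\bigl(Y(w_ZZ+w_SS)\bigr)\bigr]+\frac{\lambda}{2}\,(w_Z^2+w_S^2),\qquad \ell(t)=\log(1+e^{-t}).$$ If $\bar\rho_{\mathrm{train}}>\gamma$, then $$\hat w_Z^\lambda+\hat w_S^\lambda>0,\qquad \hat w_Z^\lambda-\hat w_S^\lambda<0 .$$ Hence $f_{\hat w^\lambda}(z,s)=s$ for every $(z,s)\in\{-1,+1\}^2$, and on any test family of the model, with shortcut correlation $\rho_{\mathrm{test}}\in[-1,1]$, $$R_{\mathrm{test}}\bigl(f_{\hat w^\lambda}\bigr)-R_{\mathrm{test}}\bigl((z,s)\mapsto z\bigr)=\frac{\gamma-\rho_{\mathrm{test}}}{2}.$$ In particular, if $\rho_{\mathrm{test}}<\gamma$, this test risk gap is strictly positive, and if $\rho_{\mathrm{test}}<0$, then $$R_{\mathrm{test}}\bigl(f_{\hat w^\lambda}\bigr)=\frac{1-\rho_{\mathrm{test}}}{2}>\frac12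 .$$
   Context: Noisy-invariant family model: fix $\gamma\in(0,1]$. Labels are $Y\in\{-1,+1\}$ and inputs are $X=(Z,S)\in\{-1,+1\}^2$. For each family $e$, indexed by a shortcut correlation $\rho_e\in[-1,1]$, $Y$ is uniform on $\{-1,+1\}$; $A,B_e\in\{-1,+1\}$ are random variables independent of $Y$ and independent of each other with $\mathbb{E}[A]=\gamma$ and $\mathbb{E}[B_e]=\rho_e$; and $Z=YA$, $S=YB_e$. Thus $\mathbb{P}(Z=Y)=\frac{1+\gamma}{2}$ and $\mathbb{P}(S=Y)=\frac{1+\rho_e}{2}$ under family $e$. The value $\gamma$ is the same for all families, including the test family. The weights satisfy $\alpha_i\ge 0$ and $\sum_i\alpha_i=1$. The training distribution of $(Y,Z,S)$ is the mixture, with weights $\alpha_i$, of the distributions of $(Y,Z,S)$ under the families $e_1,\dots,e_m$ (equivalently, a random family index $E\sim\sum_i\alpha_i\delta_{e_i}$ independent of $(Y,A)$ is drawn and $S=YB_E$); $\mathbb{E}_{\mathrm{train}}$ denotes expectation under it. In particular, under training $YZ$ and $YS$ are independent with means $\gamma$ and $\bar\rho_{\mathrm{train}}$. For $w=(w_Z,w_S)\in\mathbb{R}^2$, the classifier is $f_w(z,s)=\mathrm{sign}(w_Zz+w_Ss)$. For a classifier $f:\{-1,+1\}^2\to\{-1,+1\}$, $R_{\mathrm{test}}(f)=\mathbb{P}_{\mathrm{test}}(f(Z,S)\neq Y)$ is its $0$-$1$ risk under the test family (the family of the model with shortcut correlation $\rho_{\mathrm{test}}$). *)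

theory Defs
  imports "HOL-Probability.Probability"
begin

text \<open>
  A family of the noisy-invariant model is given by the joint law \<open>P\<close> of the triple
  \<open>(Y, A, B)\<close>.  All three variables are \<open>\<plusminus>1\<close>-valued, so a \<open>pmf\<close> loses no
  generality over random variables on an arbitrary probability space.
\<close>

definition noisy_family :: "real \<Rightarrow> real \<Rightarrow> (real \<times> real \<times> real) pmf \<Rightarrow> bool" where
  "noisy_family \<gamma> \<rho> P \<longleftrightarrow>
     \<rho> \<in> {-1..1} \<and>
     set_pmf P \<subseteq> {-1, 1} \<times> {-1, 1} \<times> {-1, 1} \<and>
     map_pmf (\<lambda>(y, a, b). y) P = pmf_of_set {-1, 1} \<and>
     prob_space.indep_vars (measure_pmf P) (\<lambda>_. count_space UNIV)
       (\<lambda>k (y, a, b). [y, a, b] ! k) {0, 1, 2} \<and>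
     measure_pmf.expectation P (\<lambda>(y, a, b). a) = \<gamma> \<and>
     measure_pmf.expectation P (\<lambda>(y, a, b). b) = \<rho>"

text \<open>The law of \<open>(Y, Z, S)\<close> with \<open>Z = Y A\<close> and \<open>S = Y B\<close>.\<close>

definition data_law :: "(real \<times> real \<times> real) pmf \<Rightarrow> (real \<times> real \<times> real) pmf" where
  "data_law P = map_pmf (\<lambda>(y, a, b). (y, y * a, y * b)) P"

text \<open>
  \<open>embed_pmf\<close> yields the intended index law only if the weights are nonnegative and sum to \<open>1\<close>;
  otherwise its value is unspecified.
\<close>

definition train_law ::
  "nat \<Rightarrow> (nat \<Rightarrow> real) \<Rightarrow> (nat \<Rightarrow> (real \<times> real \<times> real) pmf) \<Rightarrow> (real \<times> real \<times> real) pmf" where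
  "train_law m \<alpha> P =
     bind_pmf (embed_pmf (\<lambda>i. if i \<in> {1..m} then \<alpha> i else 0)) (\<lambda>i. data_law (P i))"

definition logistic_loss :: "real \<Rightarrow> real" where
  "logistic_loss t = ln (1 + exp (- t))"

definition ridge_objective :: "real \<Rightarrow> (real \<times> real \<times> real) pmf \<Rightarrow> real \<times> real \<Rightarrow> real" where
  "ridge_objective l D = (\<lambda>(wZ, wS).
     measure_pmf.expectation D (\<lambda>(y, z, s). logistic_loss (y * (wZ * z + wS * s)))
     + l / 2 * (wZ\<^sup>2 + wS\<^sup>2))"

definition ridge_minimizer :: "real \<Rightarrow> (real \<times> real \<times> real) pmf \<Rightarrow> real \<times> real" where
  "ridge_minimizer l D = (THE w. is_arg_min (ridge_objective l D) (\<lambda>_. True) w)"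

text \<open>The value at \<open>wZ * z + wS * s = 0\<close> is \<open>sgn 0 = 0\<close>, which equals neither label.\<close>

definition linear_classifier :: "real \<times> real \<Rightarrow> real \<times> real \<Rightarrow> real" where
  "linear_classifier = (\<lambda>(wZ, wS) (z, s). sgn (wZ * z + wS * s))"

definition risk :: "(real \<times> real \<times> real) pmf \<Rightarrow> (real \<times> real \<Rightarrow> real) \<Rightarrow> real" where
  "risk D f = measure_pmf.prob D {(y, z, s). f (z, s) \<noteq> y}"

end

theory Submission
  imports Defs
begin

text \<open>
  On the support \<open>Y Z\<close> and \<open>Y S\<close> are signs, and \<open>\<ell>(t) + t/2\<close> is even.  In the coordinates
  \<open>u = w_Z + w_S\<close>, \<open>v = w_Z - w_S\<close> the objective therefore splits into a function of \<open>u\<close> plus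
  a function of \<open>v\<close>, each of the form \<open>c (\<ell>(t) + t/2) - k t + \<lambda> t\<^sup>2 / 4\<close> with \<open>c \<ge> 0\<close> and
  \<open>k = (\<gamma> \<plusminus> \<rho>) / 4\<close>.  Such a function is strictly convex with slope \<open>-k\<close> at \<open>0\<close>, so its unique
  minimizer has the sign of \<open>k\<close>.
\<close>

section \<open>One-variable profiles and their unique minimizers\<close>

text \<open>The bracket is the even function \<open>ln (2 * cosh (t / 2))\<close>. The factor
  \<open>l / 4\<close> comes from wZ^2 + wS^2 = (u^2 + v^2) / 2.\<close>

definition ridge_profile :: "real \<Rightarrow> real \<Rightarrow> real \<Rightarrow> real \<Rightarrow> real" where
  "ridge_profile c k l t = c * (logistic_loss t + t / 2) - k * t + l / 4 * t\<^sup>2"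

lemma logistic_loss_minus: "logistic_loss (- t) = logistic_loss t + t"
proof -
  have "1 + exp t = exp t * (1 + exp (- t))"
    by (simp add: distrib_left exp_minus)
  moreover have "1 + exp (- t) > 0"
    by (simp add: add_pos_pos)
  ultimately have "ln (1 + exp t) = t + ln (1 + exp (- t))"
    by (metis exp_gt_zero ln_exp ln_mult_pos)
  then show ?thesis
    by (simp add: logistic_loss_def)
qed

text \<open>Reflection fixes the two even terms and flips only the linear one, so the case k < 0
  reduces to k > 0.\<close>

lemma ridge_profile_minus: "ridge_profile c k l (- t) = ridge_profile c (- k) l t"
  by (simp add: ridge_profile_def logistic_loss_minus algebra_simps)

lemma ridge_profile_deriv:
  "(ridge_profile c k l has_real_derivative c * (1 / 2 - 1 / (1 + exp t)) - k + l / 2 * t) (at t)"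
proof -
  have pos: "1 + exp (- t) > 0" "1 + exp t > 0"
    by (simp_all add: add_pos_pos)
  \<comment> \<open>This form of the logistic derivative makes its monotonicity visible from that of
    \<open>exp\<close>.\<close>
  have "exp (- t) / (1 + exp (- t)) = 1 / (1 + exp t)"
    using pos by (simp add: exp_minus field_simps)
  then show ?thesis
    unfolding ridge_profile_def logistic_loss_def
    using pos by (auto intro!: derivative_eq_intros simp: algebra_simps)
qed

text \<open>The derivative is strictly increasing, thanks to the ridge term even when c = 0, and
  equals -k < 0 at 0. Its only zero is therefore positive and is the strict global
  minimizer.\<close>

lemma ridge_profile_minimizer_pos:
  assumes "0 \<le> c" "0 < k" "0 < l"
  shows "\<exists>t0 > 0. \<forall>t. t \<noteq> t0 \<longrightarrow> ridge_profile c k l t0 < ridge_profile c k l t"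
proof -
  define g' where "g' = (\<lambda>t. c * (1 / 2 - 1 / (1 + exp t)) - k + l / 2 * t)"
  have pos: "1 + exp t > 0" for t :: real
    by (simp add: add_pos_pos)
  have deriv: "(ridge_profile c k l has_real_derivative g' t) (at t)" for t
    unfolding g'_def by (rule ridge_profile_deriv)
  have mono: "g' s < g' t" if "s < t" for s t
  proof -
    have "1 / (1 + exp t) \<le> 1 / (1 + exp s)"
      using that pos by (intro divide_left_mono) auto
    then have "c * (1 / 2 - 1 / (1 + exp s)) \<le> c * (1 / 2 - 1 / (1 + exp t))"
      using assms by (intro mult_left_mono) auto
    moreover have "l / 2 * s < l / 2 * t"
      using that assms by simp
    ultimately show ?thesis
      by (simp add: g'_def)
  qed
  have g'0: "g' 0 < 0"
    using assms by (simp add: g'_def)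
  \<comment> \<open>At 2k/l the ridge slope cancels -k exactly. What remains is the logistic part,
    which is nonnegative to the right of 0.\<close>
  have "1 / (1 + exp (2 * k / l)) \<le> 1 / 2"
    using assms by (intro divide_left_mono) (auto simp: add_pos_pos)
  then have "g' (2 * k / l) \<ge> 0"
    using assms by (simp add: g'_def)
  moreover have "continuous_on {0..2 * k / l} g'"
    unfolding g'_def using pos by (intro continuous_intros) (metis less_irrefl)
  ultimately obtain t0 where t0: "0 \<le> t0" "g' t0 = 0"
    using IVT'[of g' 0 0 "2 * k / l"] g'0 assms by auto
  \<comment> \<open>On either side of \<open>t0\<close> the mean value theorem turns the sign of
    \<open>g'\<close> into a strict inequality.\<close>
  have "ridge_profile c k l t0 < ridge_profile c k l t" if "t \<noteq> t0" for t
  proof (cases "t < t0")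
    case True
    obtain z where "t < z" "z < t0"
      "ridge_profile c k l t0 - ridge_profile c k l t = (t0 - t) * g' z"
      using MVT2[OF True deriv] by blast
    moreover have "(t0 - t) * g' z < 0"
      using True mono[of z t0] t0 \<open>z < t0\<close> by (simp add: mult_pos_neg)
    ultimately show ?thesis by simp
  next
    case False
    then have *: "t0 < t" using that by simp
    obtain z where "t0 < z" "z < t"
      "ridge_profile c k l t - ridge_profile c k l t0 = (t - t0) * g' z"
      using MVT2[OF * deriv] by blast
    moreover have "(t - t0) * g' z > 0"
      using * mono[of t0 z] t0 \<open>t0 < z\<close> by simp
    ultimately show ?thesis by simp
  qed
  moreover have "t0 > 0"
    using t0 g'0 by (cases "t0 = 0") auto
  ultimately show ?thesis by blast
qed

lemma ridge_profile_minimizer_neg: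
  assumes "0 \<le> c" "k < 0" "0 < l"
  shows "\<exists>t0 < 0. \<forall>t. t \<noteq> t0 \<longrightarrow> ridge_profile c k l t0 < ridge_profile c k l t"
proof -
  obtain t0 where t0: "t0 > 0"
    "\<And>t. t \<noteq> t0 \<Longrightarrow> ridge_profile c (- k) l t0 < ridge_profile c (- k) l t"
    using ridge_profile_minimizer_pos[of c "- k" l] assms by auto
  have "ridge_profile c k l (- t0) < ridge_profile c k l t" if "t \<noteq> - t0" for t
    using t0(2)[of "- t"] that ridge_profile_minus[of c k l t0] ridge_profile_minus[of c "- k" l t]
    by (auto simp: minus_equation_iff)
  then show ?thesis
    using t0(1) by (intro exI[of _ "- t0"]) auto
qed

section \<open>Splitting the objective in the coordinates u and v\<close>

text \<open>The factors (1 + zs)/2 and (1 - zs)/2 indicate z = s and z \<noteq> s, where the margin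
  is u or v up to sign. The even part of the loss ignores that sign; it survives only in the linear
  term, which is minus half the margin.\<close>

lemma logistic_loss_signs:
  assumes "y \<in> {-1, 1}" "z \<in> {-1, 1}" "s \<in> {-1, 1}"
  shows "logistic_loss (y * (wZ * z + wS * s)) =
    (1 + z * s) / 2 * (logistic_loss (wZ + wS) + (wZ + wS) / 2) +
    (1 - z * s) / 2 * (logistic_loss (wZ - wS) + (wZ - wS) / 2) -
    (wZ * (y * z) + wS * (y * s)) / 2"
  using assms logistic_loss_minus[of "wZ + wS"] logistic_loss_minus[of "wZ - wS"]
  by (auto simp: field_simps)

lemma integrable_signs:
  fixes D :: "(real \<times> real \<times> real) pmf" and f :: "real \<times> real \<times> real \<Rightarrow> real"
  assumes "set_pmf D \<subseteq> {-1, 1} \<times> {-1, 1} \<times> {-1, 1}"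
  shows "integrable (measure_pmf D) f"
  by (rule integrable_measure_pmf_finite) (rule finite_subset[OF assms], simp)

text \<open>The weight c is the probability of z = s under \<open>D\<close>. Its range suffices,
  because the sign of each profile's minimizer does not depend on it. The slopes come from (wZ
  \<gamma> + wS r)/2 = u (\<gamma> + r)/4 + v (\<gamma> - r)/4.\<close>

lemma ridge_objective_split:
  assumes D: "set_pmf D \<subseteq> {-1, 1} \<times> {-1, 1} \<times> {-1, 1}"
    and Z: "measure_pmf.expectation D (\<lambda>(y, z, s). y * z) = \<gamma>"
    and S: "measure_pmf.expectation D (\<lambda>(y, z, s). y * s) = r"
  obtains c where "0 \<le> c" "c \<le> 1" "\<And>wZ wS. ridge_objective l D (wZ, wS) =
    ridge_profile c ((\<gamma> + r) / 4) l (wZ + wS) + ridge_profile (1 - c) ((\<gamma> - r) / 4) l (wZ - wS)"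
proof -
  let ?q = "measure_pmf.expectation D (\<lambda>(y, z, s). z * s)"
  have int: "integrable (measure_pmf D) f" for f :: "_ \<Rightarrow> real"
    by (rule integrable_signs[OF D])
  have zs: "-1 \<le> z * s" "z * s \<le> 1" if "(y, z, s) \<in> set_pmf D" for y z s
    using that D by auto
  have "?q \<le> 1"
    by (rule measure_pmf.integral_le_const[OF int]) (auto simp: AE_measure_pmf_iff zs)
  moreover have "-1 \<le> ?q"
    by (rule measure_pmf.integral_ge_const[OF int]) (auto simp: AE_measure_pmf_iff zs)
  moreover have "ridge_objective l D (wZ, wS) =
      ridge_profile ((1 + ?q) / 2) ((\<gamma> + r) / 4) l (wZ + wS) +
      ridge_profile (1 - (1 + ?q) / 2) ((\<gamma> - r) / 4) l (wZ - wS)" for wZ wS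
  proof -
    \<comment> \<open>With the even parts at u and v named, the loss is affine in zs, yz and ys on
      the support, so its expectation involves only three correlations.\<close>
    define p where "p = logistic_loss (wZ + wS) + (wZ + wS) / 2"
    define n where "n = logistic_loss (wZ - wS) + (wZ - wS) / 2"
    have "measure_pmf.expectation D (\<lambda>(y, z, s). logistic_loss (y * (wZ * z + wS * s))) =
      measure_pmf.expectation D (\<lambda>x. (p + n) / 2 + (p - n) / 2 * (case x of (y, z, s) \<Rightarrow> z * s) -
        wZ / 2 * (case x of (y, z, s) \<Rightarrow> y * z) - wS / 2 * (case x of (y, z, s) \<Rightarrow> y * s))"
    proof (rule integral_cong_AE)
      have "logistic_loss (y * (wZ * z + wS * s)) =
          (p + n) / 2 + (p - n) / 2 * (z * s) - wZ / 2 * (y * z) - wS / 2 * (y * s)"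
        if "(y, z, s) \<in> set_pmf D" for y z s
        using logistic_loss_signs[of y z s wZ wS] that D unfolding p_def[symmetric] n_def[symmetric]
        by (auto simp: field_simps)
      then show "AE x in measure_pmf D. (case x of (y, z, s) \<Rightarrow> logistic_loss (y * (wZ * z + wS * s))) =
        (p + n) / 2 + (p - n) / 2 * (case x of (y, z, s) \<Rightarrow> z * s) -
        wZ / 2 * (case x of (y, z, s) \<Rightarrow> y * z) - wS / 2 * (case x of (y, z, s) \<Rightarrow> y * s)"
        by (auto simp: AE_measure_pmf_iff)
    qed simp_all
    also have "\<dots> = (p + n) / 2 + (p - n) / 2 * ?q - wZ / 2 * \<gamma> - wS / 2 * r"
      by (simp only: Bochner_Integration.integral_diff[OF int int]
          Bochner_Integration.integral_add[OF int int] integral_mult_right_zero Z S)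
        simp
    finally show ?thesis
      by (simp add: ridge_objective_def ridge_profile_def p_def n_def field_simps power2_eq_square)
  qed
  ultimately show thesis
    by (intro that[of "(1 + ?q) / 2"]) auto
qed

text \<open>Since w and (u, v) determine each other, the two profiles are minimized separately;
  \<gamma> < r makes their slope parameters positive and negative respectively. Uniqueness gives the
  \<open>THE\<close> in \<open>ridge_minimizer\<close> its meaning.\<close>

lemma ridge_minimizer_signs:
  assumes D: "set_pmf D \<subseteq> {-1, 1} \<times> {-1, 1} \<times> {-1, 1}"
    and Z: "measure_pmf.expectation D (\<lambda>(y, z, s). y * z) = \<gamma>"
    and S: "measure_pmf.expectation D (\<lambda>(y, z, s). y * s) = r"
    and "0 < l" "0 < \<gamma>" "\<gamma> < r"
  shows "\<exists>!v. is_arg_min (ridge_objective l D) (\<lambda>_. True) v"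
    and "fst (ridge_minimizer l D) + snd (ridge_minimizer l D) > 0"
    and "fst (ridge_minimizer l D) - snd (ridge_minimizer l D) < 0"
proof -
  let ?J = "ridge_objective l D"
  obtain c where c: "0 \<le> c" "c \<le> 1" and J: "\<And>wZ wS. ?J (wZ, wS) =
    ridge_profile c ((\<gamma> + r) / 4) l (wZ + wS) + ridge_profile (1 - c) ((\<gamma> - r) / 4) l (wZ - wS)"
    using ridge_objective_split[OF D Z S] by blast
  obtain u where u: "u > 0" "\<And>t. t \<noteq> u \<Longrightarrow>
      ridge_profile c ((\<gamma> + r) / 4) l u < ridge_profile c ((\<gamma> + r) / 4) l t"
    using ridge_profile_minimizer_pos[of c "(\<gamma> + r) / 4" l] c assms(4-) by auto
  obtain v where v: "v < 0" "\<And>t. t \<noteq> v \<Longrightarrow>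
      ridge_profile (1 - c) ((\<gamma> - r) / 4) l v < ridge_profile (1 - c) ((\<gamma> - r) / 4) l t"
    using ridge_profile_minimizer_neg[of "1 - c" "(\<gamma> - r) / 4" l] c assms(4-) by auto
  define w where "w = ((u + v) / 2, (u - v) / 2)"
  have w: "fst w + snd w = u" "fst w - snd w = v"
    by (simp_all add: w_def field_simps)
  have less: "?J w < ?J x" if "x \<noteq> w" for x
  proof -
    obtain a b where x: "x = (a, b)" by (cases x)
    \<comment> \<open>A competitor differs in at least one of u, v: that profile is strictly larger,
      and the other is no smaller.\<close>
    have ne: "a + b \<noteq> u \<or> a - b \<noteq> v"
      using that by (auto simp: x w_def)
    have Jw: "?J w = ridge_profile c ((\<gamma> + r) / 4) l u + ridge_profile (1 - c) ((\<gamma> - r) / 4) l v"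
      using J[of "fst w" "snd w"] w by simp
    show ?thesis
      using u(2)[of "a + b"] v(2)[of "a - b"] ne unfolding Jw x J
      by (cases "a + b = u"; cases "a - b = v") auto
  qed
  have min: "is_arg_min ?J (\<lambda>_. True) x \<longleftrightarrow> x = w" for x
    using less unfolding is_arg_min_def by (metis less_asym)
  then show "\<exists>!v. is_arg_min ?J (\<lambda>_. True) v"
    by simp
  have "ridge_minimizer l D = w"
    by (simp add: ridge_minimizer_def min)
  then show "fst (ridge_minimizer l D) + snd (ridge_minimizer l D) > 0"
    and "fst (ridge_minimizer l D) - snd (ridge_minimizer l D) < 0"
    using w u(1) v(1) by simp_all
qed

section \<open>The induced classifier, correlations and risks\<close>

text \<open>The two inequalities say |wZ| < wS, so the shortcut term dominates and the argument of
  \<open>sgn\<close> is never 0.\<close>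

lemma linear_classifier_shortcut:
  assumes "fst w + snd w > 0" "fst w - snd w < 0" "z \<in> {-1, 1}" "s \<in> {-1, 1}"
  shows "linear_classifier w (z, s) = s"
  using assms by (auto simp: linear_classifier_def sgn_if split: prod.splits)

text \<open>As y^2 = 1 on the support, yz and ys recover a and b.\<close>

lemma data_law_signs:
  assumes "noisy_family \<gamma> \<rho> P"
  shows "set_pmf (data_law P) \<subseteq> {-1, 1} \<times> {-1, 1} \<times> {-1, 1}"
    and "measure_pmf.expectation (data_law P) (\<lambda>(y, z, s). y * z) = \<gamma>"
    and "measure_pmf.expectation (data_law P) (\<lambda>(y, z, s). y * s) = \<rho>"
proof -
  have P: "set_pmf P \<subseteq> {-1, 1} \<times> {-1, 1} \<times> {-1, 1}"
    and EA: "measure_pmf.expectation P (\<lambda>(y, a, b). a) = \<gamma>"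
    and EB: "measure_pmf.expectation P (\<lambda>(y, a, b). b) = \<rho>"
    using assms by (auto simp: noisy_family_def)
  show "set_pmf (data_law P) \<subseteq> {-1, 1} \<times> {-1, 1} \<times> {-1, 1}"
    using P by (fastforce simp: data_law_def)
  have "measure_pmf.expectation (data_law P) (\<lambda>(y, z, s). y * z) =
      measure_pmf.expectation P (\<lambda>(y, a, b). a)"
    unfolding data_law_def integral_map_pmf
    using P by (intro integral_cong_AE) (auto simp: AE_measure_pmf_iff)
  then show "measure_pmf.expectation (data_law P) (\<lambda>(y, z, s). y * z) = \<gamma>"
    using EA by simp
  have "measure_pmf.expectation (data_law P) (\<lambda>(y, z, s). y * s) =
      measure_pmf.expectation P (\<lambda>(y, a, b). b)"
    unfolding data_law_def integral_map_pmf
    using P by (intro integral_cong_AE) (auto simp: AE_measure_pmf_iff)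
  then show "measure_pmf.expectation (data_law P) (\<lambda>(y, z, s). y * s) = \<rho>"
    using EB by simp
qed

text \<open>For signs the error indicator is (1 - y f)/2, so the risk is an affine function of the
  correlation of the prediction with the label.\<close>

lemma risk_eq_correlation:
  assumes D: "set_pmf D \<subseteq> {-1, 1} \<times> {-1, 1} \<times> {-1, 1}"
    and f: "\<And>z s. z \<in> {-1, 1} \<Longrightarrow> s \<in> {-1, 1} \<Longrightarrow> f (z, s) \<in> {-1, 1}"
  shows "risk D f = (1 - measure_pmf.expectation D (\<lambda>(y, z, s). y * f (z, s))) / 2"
proof -
  have int: "integrable (measure_pmf D) g" for g :: "_ \<Rightarrow> real"
    by (rule integrable_signs[OF D])
  have "risk D f = measure_pmf.expectation D (indicator {(y, z, s). f (z, s) \<noteq> y})"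
    by (simp add: risk_def)
  also have "\<dots> = measure_pmf.expectation D (\<lambda>x. 1 / 2 - 1 / 2 * (case x of (y, z, s) \<Rightarrow> y * f (z, s)))"
  proof (rule integral_cong_AE)
    have "indicator {(y, z, s). f (z, s) \<noteq> y} (y, z, s) = 1 / 2 - 1 / 2 * (y * f (z, s))"
      if "(y, z, s) \<in> set_pmf D" for y z s
      using f[of z s] that D by (auto simp: indicator_def)
    then show "AE x in measure_pmf D. indicator {(y, z, s). f (z, s) \<noteq> y} x =
        1 / 2 - 1 / 2 * (case x of (y, z, s) \<Rightarrow> y * f (z, s))"
      by (auto simp: AE_measure_pmf_iff)
  qed simp_all
  also have "\<dots> = 1 / 2 - 1 / 2 * measure_pmf.expectation D (\<lambda>(y, z, s). y * f (z, s))"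
    by (simp only: Bochner_Integration.integral_diff[OF int int] integral_mult_right_zero) simp
  finally show ?thesis by simp
qed

text \<open>Expectations under the mixture are weighted averages over the families: the common value
  \<gamma> is preserved, while the shortcut correlations average.\<close>

lemma train_law_signs:
  assumes families: "\<And>i. i \<in> {1..m} \<Longrightarrow> noisy_family \<gamma> (\<rho> i) (P i)"
    and weights: "\<And>i. i \<in> {1..m} \<Longrightarrow> 0 \<le> \<alpha> i" "(\<Sum>i = 1..m. \<alpha> i) = 1"
  shows "set_pmf (train_law m \<alpha> P) \<subseteq> {-1, 1} \<times> {-1, 1} \<times> {-1, 1}"
    and "measure_pmf.expectation (train_law m \<alpha> P) (\<lambda>(y, z, s). y * z) = \<gamma>"
    and "measure_pmf.expectation (train_law m \<alpha> P) (\<lambda>(y, z, s). y * s) = (\<Sum>i = 1..m. \<alpha> i * \<rho> i)"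
proof -
  define a where "a = (\<lambda>i. if i \<in> {1..m} then \<alpha> i else 0)"
  have a_nonneg: "0 \<le> a i" for i
    using weights(1) by (simp add: a_def)
  \<comment> \<open>Total mass one is what lets \<open>embed_pmf\<close> return the prescribed
    weights.\<close>
  have "(\<integral>\<^sup>+ i. ennreal (a i) \<partial>count_space UNIV) = (\<Sum>i\<in>{1..m}. ennreal (a i))"
    by (rule nn_integral_count_space'[where A = "{1..m}"]) (auto simp: a_def)
  also have "\<dots> = ennreal (\<Sum>i\<in>{1..m}. a i)"
    using a_nonneg by (simp add: sum_ennreal)
  also have "\<dots> = 1"
    using weights(2) by (simp add: a_def)
  finally have a_one: "(\<integral>\<^sup>+ i. ennreal (a i) \<partial>count_space UNIV) = 1" .
  have pmf_a: "pmf (embed_pmf a) i = a i" for i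
    by (rule pmf_embed_pmf[OF a_nonneg a_one])
  \<comment> \<open>Indices outside \<open>{1..m}\<close> must have no mass, as nothing is assumed
    about \<open>P\<close> there.\<close>
  have set_a: "set_pmf (embed_pmf a) \<subseteq> {1..m}"
  proof
    fix i
    assume "i \<in> set_pmf (embed_pmf a)"
    then have "a i \<noteq> 0"
      by (simp add: set_pmf_iff pmf_a)
    then show "i \<in> {1..m}"
      by (auto simp: a_def split: if_splits)
  qed
  have T: "train_law m \<alpha> P = embed_pmf a \<bind> (\<lambda>i. data_law (P i))"
    by (simp add: train_law_def a_def)
  have signs: "set_pmf (data_law (P i)) \<subseteq> {-1, 1} \<times> {-1, 1} \<times> {-1, 1}" if "i \<in> {1..m}" for i
    by (rule data_law_signs(1)[OF families[OF that]])
  show "set_pmf (train_law m \<alpha> P) \<subseteq> {-1, 1} \<times> {-1, 1} \<times> {-1, 1}"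
    using set_a signs by (fastforce simp: T)
  have E: "measure_pmf.expectation (train_law m \<alpha> P) h =
      (\<Sum>i = 1..m. \<alpha> i * measure_pmf.expectation (data_law (P i)) h)"
    for h :: "real \<times> real \<times> real \<Rightarrow> real"
  proof -
    have "measure_pmf.expectation (train_law m \<alpha> P) h =
        (\<Sum>i = 1..m. pmf (embed_pmf a) i *\<^sub>R measure_pmf.expectation (data_law (P i)) h)"
      unfolding T using set_a signs
      by (intro pmf_expectation_bind) (auto intro: finite_subset)
    also have "\<dots> = (\<Sum>i = 1..m. \<alpha> i * measure_pmf.expectation (data_law (P i)) h)"
      unfolding pmf_a by (intro sum.cong) (simp_all add: a_def)
    finally show ?thesis .
  qed
  show "measure_pmf.expectation (train_law m \<alpha> P) (\<lambda>(y, z, s). y * z) = \<gamma>"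
    using data_law_signs(2)[OF families] weights(2) by (simp add: E sum_distrib_right[symmetric])
  show "measure_pmf.expectation (train_law m \<alpha> P) (\<lambda>(y, z, s). y * s) = (\<Sum>i = 1..m. \<alpha> i * \<rho> i)"
    using data_law_signs(3)[OF families] by (simp add: E)
qed

theorem theorem2:
  fixes \<gamma> l :: real and m :: nat and \<alpha> \<rho> :: "nat \<Rightarrow> real"
    and P :: "nat \<Rightarrow> (real \<times> real \<times> real) pmf"
  defines "w \<equiv> ridge_minimizer l (train_law m \<alpha> P)"
  assumes gamma: "0 < \<gamma>" "\<gamma> \<le> 1"
    and families: "\<And>i. i \<in> {1..m} \<Longrightarrow> noisy_family \<gamma> (\<rho> i) (P i)"
    and weights: "\<And>i. i \<in> {1..m} \<Longrightarrow> 0 \<le> \<alpha> i" "(\<Sum>i = 1..m. \<alpha> i) = 1"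
    and l: "0 < l"
    and correlation: "(\<Sum>i = 1..m. \<alpha> i * \<rho> i) > \<gamma>"
  shows "(\<exists>!v. is_arg_min (ridge_objective l (train_law m \<alpha> P)) (\<lambda>_. True) v) \<and>
    fst w + snd w > 0 \<and> fst w - snd w < 0 \<and>
    (\<forall>z \<in> {-1, 1}. \<forall>s \<in> {-1, 1}. linear_classifier w (z, s) = s) \<and>
    (\<forall>\<rho>_test P_test. noisy_family \<gamma> \<rho>_test P_test \<longrightarrow>
      (let R_test = risk (data_law P_test) in
        R_test (linear_classifier w) - R_test (\<lambda>(z, s). z) = (\<gamma> - \<rho>_test) / 2 \<and>
        (\<rho>_test < \<gamma> \<longrightarrow> R_test (linear_classifier w) - R_test (\<lambda>(z, s). z) > 0) \<and>
        (\<rho>_test < 0 \<longrightarrow> R_test (linear_classifier w) = (1 - \<rho>_test) / 2 \<and>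
          R_test (linear_classifier w) > 1 / 2)))"
proof -
  note train = train_law_signs[OF families weights]
  note minimizer = ridge_minimizer_signs[OF train l gamma(1) correlation, folded w_def]
  have classifier: "linear_classifier w (z, s) = s" if "z \<in> {-1, 1}" "s \<in> {-1, 1}" for z s
    by (rule linear_classifier_shortcut[OF minimizer(2,3) that])
  \<comment> \<open>Each of the two classifiers agrees with one coordinate on the support, so its
    risk is read off from \<rho>' or \<gamma>. The test claims are then arithmetic.\<close>
  have risk_w: "risk (data_law Q) (linear_classifier w) = (1 - \<rho>') / 2"
    and risk_z: "risk (data_law Q) (\<lambda>(z, s). z) = (1 - \<gamma>) / 2"
    if Q: "noisy_family \<gamma> \<rho>' Q" for \<rho>' Q
  proof -
    note D = data_law_signs[OF Q]
    have "measure_pmf.expectation (data_law Q) (\<lambda>(y, z, s). y * linear_classifier w (z, s)) =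
        measure_pmf.expectation (data_law Q) (\<lambda>(y, z, s). y * s)"
    proof (rule integral_cong_AE)
      show "AE x in measure_pmf (data_law Q). (case x of (y, z, s) \<Rightarrow> y * linear_classifier w (z, s)) =
          (case x of (y, z, s) \<Rightarrow> y * s)"
        using D(1) by (auto simp: AE_measure_pmf_iff classifier)
    qed simp_all
    then show "risk (data_law Q) (linear_classifier w) = (1 - \<rho>') / 2"
      using D(3) classifier by (subst risk_eq_correlation[OF D(1)]) auto
    show "risk (data_law Q) (\<lambda>(z, s). z) = (1 - \<gamma>) / 2"
      using D(2) by (subst risk_eq_correlation[OF D(1)]) auto
  qed
  have "(let R_test = risk (data_law Q) in
        R_test (linear_classifier w) - R_test (\<lambda>(z, s). z) = (\<gamma> - \<rho>') / 2 \<and>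
        (\<rho>' < \<gamma> \<longrightarrow> R_test (linear_classifier w) - R_test (\<lambda>(z, s). z) > 0) \<and>
        (\<rho>' < 0 \<longrightarrow> R_test (linear_classifier w) = (1 - \<rho>') / 2 \<and>
          R_test (linear_classifier w) > 1 / 2))"
    if "noisy_family \<gamma> \<rho>' Q" for \<rho>' Q
    unfolding Let_def risk_w[OF that] risk_z[OF that] by (simp add: field_simps)
  then show ?thesis
    using minimizer classifier by blast
qed

end
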